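(* Let $A,B \subseteq 2^{\mathbb{N}}$ be disjoint. Then there is a function $f \colon 2^{\mathbb{N}} \times 2^{\mathbb{N}} \to \mathbb{N}$ solving $\mathrm{KW}_{A,B}$ (that is, for all $(x,y) \in A \times B$, the strings $x$ and $y$ differ at index $f(x,y)$) such that $2^{\mathbb{N}} \times 2^{\mathbb{N}}$ has a countable partition into $f$-monochromatic rectangles.
   Context: $2^{\mathbb{N}}$ is the set of infinite binary strings $x = x_0x_1\cdots$. A rectangle in $X \times Y$ is a set of the form $S \times T$ with $S \subseteq X$ and $T \subseteq Y$. A rectangle $R$ is $f$-monochromatic if $f$ is constant on $R$. The Karchmer--Wigderson game $\mathrm{KW}_{A,B}$ is the problem of outputting, given $x \in A$ and $y \in B$, an index $i \in \mathbb{N}$ with $x_i \neq y_i$. *)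

theory Defs
  imports "HOL-Analysis.Abstract_Topology_2" "HOL-Library.Disjoint_Sets" "HOL-Library.Countable_Set"
begin

text \<open>Elements of the Cantor space are functions from \<open>nat\<close> to \<open>bool\<close>, the bit \<open>1\<close> being \<open>True\<close>;
  the space itself is \<open>UNIV\<close>.\<close>

type_synonym cantor = "nat \<Rightarrow> bool"

definition rectangle :: "'a set \<Rightarrow> 'b set \<Rightarrow> ('a \<times> 'b) set \<Rightarrow> bool" where
  "rectangle X Y R \<longleftrightarrow> (\<exists>S T. S \<subseteq> X \<and> T \<subseteq> Y \<and> R = S \<times> T)"

definition monochromatic :: "('a \<Rightarrow> 'c) \<Rightarrow> 'a set \<Rightarrow> bool" where
  "monochromatic f R \<longleftrightarrow> f constant_on R"

text \<open>The values of \<open>f\<close> outside \<open>A \<times> B\<close> are unconstrained.\<close>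

definition solves_KW :: "cantor set \<Rightarrow> cantor set \<Rightarrow> (cantor \<times> cantor \<Rightarrow> nat) \<Rightarrow> bool" where
  "solves_KW A B f \<longleftrightarrow> (\<forall>x\<in>A. \<forall>y\<in>B. x (f (x, y)) \<noteq> y (f (x, y)))"

end

theory Submission
  imports Defs
begin

text \<open>
  Two strings \<open>x \<in> A\<close> and \<open>y \<in> B\<close> are distinct because \<open>A\<close> and \<open>B\<close> are disjoint, so they have a
  first difference. That two strings have their first difference right after the common prefix \<open>s\<close>,
  with \<open>x\<close> taking the bit \<open>b\<close> there, is a condition on \<open>x\<close> (it extends \<open>s b\<close>) together with a
  condition on \<open>y\<close> (it extends \<open>s \<not>b\<close>); it therefore cuts a rectangle out of \<open>A \<times> B\<close>, on which the position
  \<open>length s\<close> of the difference is constant. There are only countably many pairs \<open>(s, b)\<close>.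

  Equal strings have no first difference, so the diagonal is missed by all of the rectangles
  above. This is harmless since the diagonal avoids \<open>A \<times> B\<close>, and the complement of \<open>A \<times> B\<close> is the
  union of the two disjoint rectangles \<open>(-A) \<times> UNIV\<close> and \<open>A \<times> (-B)\<close>, where any constant answer is
  allowed.

  The partition is obtained as the family of fibres of a map \<open>piece\<close> into a countable type, whose
  value at \<open>(x, y)\<close> records which of these rectangles contains \<open>(x, y)\<close>. The solution of the game is
  then read off from the value of \<open>piece\<close>, so it is automatically constant on each fibre.
\<close>

lemma partition_on_fibres:
  "partition_on UNIV ((\<lambda>c. k -` {c}) ` range k)"
  by (rule partition_onI) (auto simp: disjnt_def)

definition first_diff :: "cantor \<Rightarrow> cantor \<Rightarrow> nat" where
  "first_diff x y = (LEAST i. x i \<noteq> y i)"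

lemma differ_at_first_diff:
  assumes "x \<noteq> y"
  shows "x (first_diff x y) \<noteq> y (first_diff x y)"
proof -
  have "\<exists>i. x i \<noteq> y i" using assms by auto
  then show ?thesis unfolding first_diff_def by (rule LeastI_ex)
qed

lemma first_diff_eq_iff:
  assumes "x \<noteq> y"
  shows "first_diff x y = n \<longleftrightarrow> (\<forall>i<n. x i = y i) \<and> x n \<noteq> y n"
proof
  assume "first_diff x y = n"
  then show "(\<forall>i<n. x i = y i) \<and> x n \<noteq> y n"
    using differ_at_first_diff[OF assms] not_less_Least unfolding first_diff_def by blast
next
  assume "(\<forall>i<n. x i = y i) \<and> x n \<noteq> y n"
  then show "first_diff x y = n"
    unfolding first_diff_def by (intro Least_equality) (auto simp flip: not_less)
qed

definition prefix_of :: "nat \<Rightarrow> cantor \<Rightarrow> bool list" where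
  "prefix_of n x = map x [0..<n]"

lemma length_prefix_of [simp]: "length (prefix_of n x) = n"
  by (simp add: prefix_of_def)

lemma prefix_of_eq_iff: "prefix_of n x = prefix_of n y \<longleftrightarrow> (\<forall>i<n. x i = y i)"
  by (auto simp: prefix_of_def)

text \<open>The left-hand side is a joint condition on \<open>x\<close> and \<open>y\<close>; the right-hand side separates the
  variables, which is what turns the corresponding set of pairs into a rectangle.\<close>

lemma first_diff_after_prefix_iff:
  assumes "x \<noteq> y"
  shows "prefix_of (first_diff x y) x = s \<and> x (first_diff x y) = b \<longleftrightarrow>
    (prefix_of (length s) x = s \<and> x (length s) = b) \<and>
    (prefix_of (length s) y = s \<and> y (length s) = (\<not> b))"
  (is "?joint \<longleftrightarrow> ?separate")
proof
  assume joint: ?joint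
  then have "first_diff x y = length s" by auto
  then show ?separate
    using joint first_diff_eq_iff[OF assms] prefix_of_eq_iff by metis
next
  assume separate: ?separate
  then have "(\<forall>i<length s. x i = y i) \<and> x (length s) \<noteq> y (length s)"
    using prefix_of_eq_iff by metis
  then have "first_diff x y = length s" using first_diff_eq_iff[OF assms] by blast
  then show ?joint using separate by simp
qed

text \<open>Inside \<open>A \<times> B\<close> the value records the common prefix and the bit of \<open>x\<close> that follows it; the
  two rectangles outside are told apart by the second component.\<close>

definition piece :: "cantor set \<Rightarrow> cantor set \<Rightarrow> cantor \<times> cantor \<Rightarrow> bool list option \<times> bool" where
  "piece A B = (\<lambda>(x, y).
    if x \<in> A \<and> y \<in> B then (Some (prefix_of (first_diff x y) x), x (first_diff x y))
    else (None, x \<in> A))"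

lemma rectangle_fibre_piece:
  assumes "A \<inter> B = {}"
  shows "rectangle UNIV UNIV (piece A B -` {c})"
proof (cases c)
  case (Pair p b)
  show ?thesis
  proof (cases p)
    case None
    have "piece A B -` {c} = (if b then A \<times> (- B) else (- A) \<times> UNIV)"
      by (auto simp: Pair None piece_def split: if_splits)
    then show ?thesis unfolding rectangle_def by (metis subset_UNIV)
  next
    case (Some s)
    define S where "S = {x \<in> A. prefix_of (length s) x = s \<and> x (length s) = b}"
    define T where "T = {y \<in> B. prefix_of (length s) y = s \<and> y (length s) = (\<not> b)}"
    have "(x, y) \<in> piece A B -` {c} \<longleftrightarrow> (x, y) \<in> S \<times> T" for x y
    proof (cases "x \<in> A \<and> y \<in> B")
      case True
      then have "x \<noteq> y" using assms by auto
      then have "(x, y) \<in> piece A B -` {c} \<longleftrightarrow>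
          (prefix_of (length s) x = s \<and> x (length s) = b) \<and>
          (prefix_of (length s) y = s \<and> y (length s) = (\<not> b))"
        unfolding first_diff_after_prefix_iff[OF \<open>x \<noteq> y\<close>, symmetric]
        using True by (simp add: Pair Some piece_def)
      then show ?thesis using True by (simp add: S_def T_def)
    next
      case False
      then show ?thesis by (auto simp: Pair Some piece_def S_def T_def)
    qed
    then have "piece A B -` {c} = S \<times> T" by auto
    then show ?thesis unfolding rectangle_def by blast
  qed
qed

theorem theorem7p1:
  fixes A B :: "cantor set"
  assumes "A \<inter> B = {}"
  shows "\<exists>f :: cantor \<times> cantor \<Rightarrow> nat. solves_KW A B f \<and>
    (\<exists>P. countable P \<and> partition_on (UNIV \<times> UNIV) P \<and>
      (\<forall>R\<in>P. rectangle UNIV UNIV R \<and> monochromatic f R))"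
proof -
  define answer :: "bool list option \<times> bool \<Rightarrow> nat"
    where "answer = (\<lambda>(p, b). case p of None \<Rightarrow> 0 | Some s \<Rightarrow> length s)"
  define f where "f = answer \<circ> piece A B"
  define P where "P = (\<lambda>c. piece A B -` {c}) ` range (piece A B)"
  have "solves_KW A B f"
    unfolding solves_KW_def
  proof (intro ballI)
    fix x y assume "x \<in> A" "y \<in> B"
    then have "x \<noteq> y" "f (x, y) = first_diff x y"
      using assms by (auto simp: f_def answer_def piece_def)
    then show "x (f (x, y)) \<noteq> y (f (x, y))" using differ_at_first_diff by simp
  qed
  moreover have "countable P" by (simp add: P_def)
  moreover have "partition_on (UNIV \<times> UNIV) P"
    using partition_on_fibres[of "piece A B"] by (simp add: P_def)
  moreover have "rectangle UNIV UNIV R \<and> monochromatic f R" if "R \<in> P" for R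
  proof -
    obtain c where R: "R = piece A B -` {c}" using \<open>R \<in> P\<close> by (auto simp: P_def)
    then have "monochromatic f R"
      by (auto simp: monochromatic_def constant_on_def f_def)
    then show ?thesis using R rectangle_fibre_piece[OF assms] by simp
  qed
  ultimately show ?thesis by blast
qed

end
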